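(* For a given $n$ and for $\pi$ a uniformly random permutation of length $n$, the probability that $\mu[1,\pi]=0$ is at least $$\left(1-\frac{1}{e}\right)^2-O\left(\frac1n\right).$$
   Context: Permutations are ordered by classical pattern containment ($\sigma\le\pi$ if $\pi$ has a subsequence order-isomorphic to $\sigma$), and $\mu[\sigma,\pi]$ is the Möbius function of this poset: $\mu[\sigma,\sigma]=1$, $\mu[\sigma,\pi]=0$ if $\sigma\not\le\pi$, and $\mu[\sigma,\pi]=-\sum_{\sigma\le\lambda<\pi}\mu[\sigma,\lambda]$ if $\sigma<\pi$. Here $1$ denotes the permutation of length one. The $O(1/n)$ term is as $n\to\infty$, i.e. bounded by $C/n$ for an absolute constant $C$. *)

theory Defs
  imports
    "HOL-Probability.Probability"
    "HOL-Library.Sublist"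
    "HOL-Combinatorics.Multiset_Permutations"
begin

text \<open>
  Permutations are given in one-line notation, so that the permutation of length one is
  \<open>[1]\<close>. The empty list also satisfies \<open>is_perm\<close>; it lies in no interval
  whose bottom is a nonempty permutation.
\<close>

definition is_perm :: "nat list \<Rightarrow> bool" where
  "is_perm \<pi> \<longleftrightarrow> \<pi> \<in> permutations_of_set {1..length \<pi>}"

definition order_isomorphic :: "nat list \<Rightarrow> nat list \<Rightarrow> bool" where
  "order_isomorphic xs ys \<longleftrightarrow>
     length xs = length ys \<and>
     (\<forall>i<length xs. \<forall>j<length xs. xs ! i < xs ! j \<longleftrightarrow> ys ! i < ys ! j)"

definition perm_le :: "nat list \<Rightarrow> nat list \<Rightarrow> bool" where
  "perm_le \<sigma> \<pi> \<longleftrightarrow>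
     is_perm \<sigma> \<and> is_perm \<pi> \<and> (\<exists>xs. subseq xs \<pi> \<and> order_isomorphic \<sigma> xs)"

definition perm_less :: "nat list \<Rightarrow> nat list \<Rightarrow> bool" where
  "perm_less \<sigma> \<pi> \<longleftrightarrow> perm_le \<sigma> \<pi> \<and> \<sigma> \<noteq> \<pi>"

lemma perm_le_refl: "is_perm \<pi> \<Longrightarrow> perm_le \<pi> \<pi>"
  by (auto simp: perm_le_def order_isomorphic_def)

lemma is_perm_nth_eq_card:
  assumes "is_perm \<pi>" "i < length \<pi>"
  shows "\<pi> ! i = Suc (card {j. j < length \<pi> \<and> \<pi> ! j < \<pi> ! i})"
proof -
  have set: "set \<pi> = {1..length \<pi>}" and dist: "distinct \<pi>"
    using permutations_of_setD[OF assms(1)[unfolded is_perm_def]] by blast+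
  let ?J = "{j. j < length \<pi> \<and> \<pi> ! j < \<pi> ! i}"
  have mem: "\<pi> ! i \<in> {1..length \<pi>}"
    using assms(2) nth_mem set by blast
  have "(!) \<pi> ` ?J = {v \<in> set \<pi>. v < \<pi> ! i}"
    by (auto simp: in_set_conv_nth)
  also have "\<dots> = {1..<\<pi> ! i}"
    using set mem by auto
  finally have "card ((!) \<pi> ` ?J) = \<pi> ! i - 1"
    by simp
  moreover have "inj_on ((!) \<pi>) ?J"
    using dist by (auto simp: inj_on_def nth_eq_iff_index_eq)
  ultimately show ?thesis
    using mem by (auto simp: card_image)
qed

lemma order_isomorphic_perms_eq:
  assumes "is_perm \<sigma>" "is_perm \<pi>" "order_isomorphic \<sigma> \<pi>"
  shows "\<sigma> = \<pi>"
proof (rule nth_equalityI)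
  show len: "length \<sigma> = length \<pi>"
    using assms(3) by (simp add: order_isomorphic_def)
  fix i assume i: "i < length \<sigma>"
  have "{j. j < length \<sigma> \<and> \<sigma> ! j < \<sigma> ! i} = {j. j < length \<pi> \<and> \<pi> ! j < \<pi> ! i}"
    using assms(3) i by (auto simp: order_isomorphic_def)
  then show "\<sigma> ! i = \<pi> ! i"
    using is_perm_nth_eq_card[OF assms(1) i] is_perm_nth_eq_card[OF assms(2), of i] i len
    by simp
qed

lemma perm_le_length: "perm_le \<sigma> \<pi> \<Longrightarrow> length \<sigma> \<le> length \<pi>"
  by (auto simp: perm_le_def order_isomorphic_def dest: list_emb_length)

lemma perm_less_length:
  assumes "perm_less \<sigma> \<pi>"
  shows "length \<sigma> < length \<pi>"
proof (rule ccontr)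
  assume "\<not> length \<sigma> < length \<pi>"
  obtain xs where xs: "subseq xs \<pi>" "order_isomorphic \<sigma> xs" "is_perm \<sigma>" "is_perm \<pi>"
    using assms by (auto simp: perm_less_def perm_le_def)
  with \<open>\<not> length \<sigma> < length \<pi>\<close> have "length xs = length \<pi>"
    using list_emb_length[OF xs(1)] by (auto simp: order_isomorphic_def)
  then have "xs = \<pi>"
    using xs(1) subseq_same_length by blast
  then show False
    using assms xs order_isomorphic_perms_eq by (auto simp: perm_less_def)
qed

lemma finite_perm_le: "finite {\<tau>. perm_le \<tau> \<pi>}"
proof (rule finite_subset)
  show "{\<tau>. perm_le \<tau> \<pi>} \<subseteq> {xs. set xs \<subseteq> {1..length \<pi>} \<and> length xs \<le> length \<pi>}"
  proof
    fix xs assume "xs \<in> {\<tau>. perm_le \<tau> \<pi>}"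
    then have "perm_le xs \<pi>" by simp
    then show "xs \<in> {xs. set xs \<subseteq> {1..length \<pi>} \<and> length xs \<le> length \<pi>}"
      using perm_le_length[of xs \<pi>]
      by (auto simp: perm_le_def is_perm_def permutations_of_set_def)
  qed
qed (simp add: finite_lists_length_le)

text \<open>
  The sum below is over a finite set by \<open>finite_perm_le\<close>.
\<close>

function perm_mobius :: "nat list \<Rightarrow> nat list \<Rightarrow> int" where
  "perm_mobius \<sigma> \<pi> =
     (if \<not> perm_le \<sigma> \<pi> then 0
      else if \<sigma> = \<pi> then 1
      else - (\<Sum>\<tau> | perm_le \<sigma> \<tau> \<and> perm_less \<tau> \<pi>. perm_mobius \<sigma> \<tau>))"
  by auto
termination
  by (relation "Wellfounded.measure (\<lambda>(\<sigma>, \<pi>). length \<pi>)") (auto intro: perm_less_length)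

declare perm_mobius.simps [simp del]

end

theory Submission
  imports Defs
begin

text \<open>
  Call two entries of a permutation an adjacency if they are neighbours both in position and in
  value; it is an up-adjacency or a down-adjacency according to the order in which they occur.
  The proof has a combinatorial half and a probabilistic half.

  If \<open>\<pi>\<close> has an up-adjacency and a down-adjacency, then \<open>\<mu>[1,\<pi>] = 0\<close>
  (\<open>perm_mobius_opposing\<close>, by induction on the length). Let \<open>P\<close> and \<open>Q\<close> be \<open>\<pi>\<close> with the
  up-adjacency, respectively the down-adjacency, collapsed to a single entry, and let \<open>R\<close> be
  \<open>\<pi>\<close> with both collapsed. A pattern that occurs in \<open>\<pi>\<close> but not after collapsing an adjacency
  must use both of its entries, and so inherits an adjacency of the same direction. Hence a proper
  pattern of \<open>\<pi>\<close> that lies below neither \<open>P\<close> nor \<open>Q\<close> has adjacencies of both directions, and so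
  does a pattern that lies below both \<open>P\<close> and \<open>Q\<close> but not below \<open>R\<close>. By induction all these
  patterns contribute \<open>0\<close>, so the sum of \<open>\<mu>[1,\<sigma>]\<close> over all \<open>\<sigma> < \<pi>\<close> equals the sum over
  \<open>[1,P]\<close> plus the sum over \<open>[1,Q]\<close> minus the sum over \<open>[1,R]\<close>. Each of the three vanishes by
  the defining recurrence, as \<open>P\<close>, \<open>Q\<close> and \<open>R\<close> have length at least two.

  It remains to bound from below the probability that a random permutation has adjacencies of both
  directions, which is \<open>1 - P(no up) - P(no down) + P(neither)\<close>. For a set \<open>T\<close> of \<open>m\<close>
  directions, the probability of having no adjacency with a direction in \<open>T\<close> is
  \<open>exp (- m) + O(1/n)\<close> (\<open>card_free_of_approx\<close>). This is inclusion-exclusion over the sets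
  \<open>V\<close> of values \<open>v\<close> such that \<open>v\<close> and \<open>v + 1\<close> are required to be neighbours in a direction
  from \<open>T\<close>: there are at most \<open>m ^ |V| * (n - |V|)!\<close> such permutations, with equality if \<open>V\<close>
  contains no two consecutive numbers (\<open>card_aligned\<close>). If equality always held, the alternating
  sum would be \<open>n!\<close> times a partial sum of the exponential series with slightly perturbed
  coefficients; the sets with consecutive numbers have total weight only \<open>O(n!/n)\<close>. Taking
  \<open>m = 1\<close> twice and \<open>m = 2\<close> once gives \<open>1 - 2/e + 1/e^2 = (1 - 1/e)^2\<close> up to \<open>O(1/n)\<close>.
\<close>

section \<open>Pattern containment for lists\<close>

(* Keeps the permutation of length one in the form [1]. *)
declare One_nat_def [simp del]

text \<open>
  Containment in an arbitrary list of distinct numbers: deleting an entry of a permutation gives a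
  list that is no longer a permutation, and its patterns can be discussed without renumbering.
\<close>

definition contains :: "nat list \<Rightarrow> nat list \<Rightarrow> bool" where
  "contains \<sigma> xs \<longleftrightarrow> (\<exists>ys. subseq ys xs \<and> order_isomorphic \<sigma> ys)"

lemma set_subseq: "subseq xs ys \<Longrightarrow> set xs \<subseteq> set ys"
  by (auto elim: list_emb_set)

lemma order_isomorphic_sym: "order_isomorphic xs ys \<Longrightarrow> order_isomorphic ys xs"
  by (simp add: order_isomorphic_def)

lemma order_isomorphic_trans:
  "order_isomorphic xs ys \<Longrightarrow> order_isomorphic ys zs \<Longrightarrow> order_isomorphic xs zs"
  by (simp add: order_isomorphic_def)

lemma order_isomorphic_map:
  assumes "strict_mono_on (set xs) f"
  shows "order_isomorphic xs (map f xs)"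
  by (simp add: order_isomorphic_def strict_mono_on_less[OF assms])

text \<open>
  An order isomorphism of lists is a strictly increasing relabelling of the entries. In this form it
  restricts to sublists and transports adjacencies.
\<close>

lemma order_isomorphic_obtain_map:
  assumes "order_isomorphic xs ys"
  obtains f where "strict_mono_on (set xs) f" "ys = map f xs"
proof -
  have len: "length ys = length xs"
    using assms by (simp add: order_isomorphic_def)
  have less: "xs ! i < xs ! j \<longleftrightarrow> ys ! i < ys ! j" if "i < length xs" "j < length xs" for i j
    using assms that by (auto simp: order_isomorphic_def)
  have same: "ys ! i = ys ! j" if "i < length xs" "j < length xs" "xs ! i = xs ! j" for i j
    using less[of i j] less[of j i] that by (metis less_irrefl linorder_neqE_nat)
  \<comment> \<open>Equal entries sit at several positions; by \<open>same\<close> the choice among them does not matter.\<close>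
  define pos where "pos x = (SOME i. i < length xs \<and> xs ! i = x)" for x
  have pos: "pos (xs ! i) < length xs \<and> xs ! pos (xs ! i) = xs ! i" if "i < length xs" for i
    unfolding pos_def by (rule someI[of _ i]) (simp add: that)
  define f where "f x = ys ! pos x" for x
  have f: "f (xs ! i) = ys ! i" if "i < length xs" for i
    unfolding f_def using pos[OF that] same that by blast
  show thesis
  proof
    show "ys = map f xs"
      by (rule nth_equalityI) (auto simp: len f)
    show "strict_mono_on (set xs) f"
      by (rule strict_mono_onI) (auto simp: in_set_conv_nth f less)
  qed
qed

lemma contains_order_isomorphic:
  assumes "order_isomorphic xs ys" "contains \<sigma> xs"
  shows "contains \<sigma> ys"
proof -
  obtain ws where ws: "subseq ws xs" "order_isomorphic \<sigma> ws"
    using assms(2) unfolding contains_def by blast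
  obtain f where f: "strict_mono_on (set xs) f" "ys = map f xs"
    using assms(1) by (rule order_isomorphic_obtain_map)
  have "order_isomorphic ws (map f ws)"
    by (rule order_isomorphic_map[OF monotone_on_subset[OF f(1) set_subseq[OF ws(1)]]])
  then have "order_isomorphic \<sigma> (map f ws)"
    by (rule order_isomorphic_trans[OF ws(2)])
  moreover have "subseq (map f ws) ys"
    unfolding f(2) using ws(1) by (rule subseq_map)
  ultimately show ?thesis
    unfolding contains_def by (intro exI conjI)
qed

lemma contains_map_iff:
  assumes "strict_mono_on (set xs) f"
  shows "contains \<sigma> (map f xs) \<longleftrightarrow> contains \<sigma> xs"
  using contains_order_isomorphic order_isomorphic_map[OF assms] order_isomorphic_sym by metis

lemma contains_mono: "contains \<sigma> ys \<Longrightarrow> subseq ys xs \<Longrightarrow> contains \<sigma> xs"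
  unfolding contains_def using subseq_order.trans[of _ ys xs] by blast

lemma contains_length: "contains \<sigma> xs \<Longrightarrow> length \<sigma> \<le> length xs"
  by (auto simp: contains_def order_isomorphic_def dest: list_emb_length)

definition standardise :: "nat list \<Rightarrow> nat list" where
  "standardise xs = map (\<lambda>x. card {y \<in> set xs. y \<le> x}) xs"

text \<open>
  Replacing each entry by its rank is strictly increasing, so a list and its standardisation contain
  the same patterns.
\<close>

lemma strict_mono_on_rank: "strict_mono_on (set xs) (\<lambda>x::nat. card {y \<in> set xs. y \<le> x})"
proof (rule strict_mono_onI)
  fix x y assume "x \<in> set xs" "y \<in> set xs" "x < y"
  then have "{z \<in> set xs. z \<le> x} \<subseteq> {z \<in> set xs. z \<le> y}" "y \<in> {z \<in> set xs. z \<le> y}"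
    "y \<notin> {z \<in> set xs. z \<le> x}"
    by auto
  then have "{z \<in> set xs. z \<le> x} \<subset> {z \<in> set xs. z \<le> y}"
    by blast
  then show "card {z \<in> set xs. z \<le> x} < card {z \<in> set xs. z \<le> y}"
    by (intro psubset_card_mono) auto
qed

lemma is_perm_standardise:
  assumes "distinct xs"
  shows "is_perm (standardise xs)"
proof -
  let ?r = "\<lambda>x. card {y \<in> set xs. y \<le> x}"
  have inj: "inj_on ?r (set xs)"
    using strict_mono_on_rank by (rule strict_mono_on_imp_inj_on)
  have "?r ` set xs = {1..length xs}"
  proof (rule card_subset_eq)
    have "?r x \<le> length xs" for x
      using card_mono[of "set xs" "{y \<in> set xs. y \<le> x}"] card_length[of xs] by auto
    moreover have "1 \<le> ?r x" if "x \<in> set xs" for x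
    proof -
      have "card {x} \<le> ?r x"
        using that by (intro card_mono) auto
      then show ?thesis
        by simp
    qed
    ultimately show "?r ` set xs \<subseteq> {1..length xs}"
      by auto
    show "card (?r ` set xs) = card {1..length xs}"
      using card_image[OF inj] assms by (simp add: distinct_card)
  qed simp
  then show ?thesis
    using assms inj
    by (simp add: is_perm_def permutations_of_set_def standardise_def distinct_map)
qed

lemma length_standardise [simp]: "length (standardise xs) = length xs"
  by (simp add: standardise_def)

lemma perm_le_iff_contains:
  "perm_le \<sigma> \<pi> \<longleftrightarrow> is_perm \<sigma> \<and> is_perm \<pi> \<and> contains \<sigma> \<pi>"
  by (simp add: perm_le_def contains_def)

lemma is_perm_distinct: "is_perm \<pi> \<Longrightarrow> distinct \<pi>"
  by (auto simp: is_perm_def permutations_of_set_def)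

lemma is_perm_singleton: "is_perm [1]"
  by (simp add: is_perm_def permutations_of_set_def One_nat_def)

lemma perm_le_singleton_iff: "perm_le [1] \<pi> \<longleftrightarrow> is_perm \<pi> \<and> \<pi> \<noteq> []"
proof -
  have "contains [1] \<pi>" if "\<pi> \<noteq> []"
  proof -
    have "subseq [hd \<pi>] \<pi>"
      using that by (metis list.collapse subseq_Cons2 list_emb_Nil)
    moreover have "order_isomorphic [1] [hd \<pi>]"
      by (simp add: order_isomorphic_def)
    ultimately show ?thesis
      by (auto simp: contains_def)
  qed
  moreover have "\<not> contains [1] []"
    using contains_length[of "[1]" "[]"] by auto
  ultimately show ?thesis
    using is_perm_singleton by (auto simp: perm_le_iff_contains)
qed

text \<open>
  For a permutation \<open>\<pi>\<close> this is the interval \<open>[1,\<pi>]\<close>; for a list of distinct numbers it is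
  the interval below its standardisation.
\<close>

definition patterns :: "nat list \<Rightarrow> nat list set" where
  "patterns xs = {\<sigma>. is_perm \<sigma> \<and> \<sigma> \<noteq> [] \<and> contains \<sigma> xs}"

lemma patterns_standardise: "patterns (standardise xs) = patterns xs"
  by (simp add: patterns_def standardise_def contains_map_iff[OF strict_mono_on_rank])

lemma patterns_perm: "is_perm \<pi> \<Longrightarrow> patterns \<pi> = {\<sigma>. perm_le [1] \<sigma> \<and> perm_le \<sigma> \<pi>}"
  unfolding patterns_def perm_le_singleton_iff by (auto simp: perm_le_iff_contains)

lemma finite_patterns:
  assumes "distinct xs" shows "finite (patterns xs)"
proof -
  have "patterns xs \<subseteq> {\<tau>. perm_le \<tau> (standardise xs)}"
    using patterns_perm[OF is_perm_standardise[OF assms]] by (auto simp: patterns_standardise)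
  then show ?thesis
    using finite_perm_le finite_subset by blast
qed

lemma perm_mobius_eq_sum_patterns:
  assumes "is_perm \<pi>" "2 \<le> length \<pi>"
  shows "perm_mobius [1] \<pi> = - (\<Sum>\<sigma>\<in>patterns \<pi> - {\<pi>}. perm_mobius [1] \<sigma>)"
proof -
  have "perm_le [1] \<pi>" "[1] \<noteq> \<pi>"
    using assms by (auto simp: perm_le_singleton_iff)
  moreover have "{\<tau>. perm_le [1] \<tau> \<and> perm_less \<tau> \<pi>} = patterns \<pi> - {\<pi>}"
    using patterns_perm[OF assms(1)] by (auto simp: perm_less_def)
  ultimately show ?thesis
    by (subst perm_mobius.simps) simp
qed

text \<open>
  The defining recurrence of the Moebius function, for the interval from \<open>1\<close> to the
  standardisation of \<open>xs\<close>. At length one the sum would be \<open>1\<close>.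
\<close>

lemma sum_perm_mobius_patterns:
  assumes "distinct xs" "2 \<le> length xs"
  shows "(\<Sum>\<sigma>\<in>patterns xs. perm_mobius [1] \<sigma>) = 0"
proof -
  define \<pi> where "\<pi> = standardise xs"
  have \<pi>: "is_perm \<pi>" "2 \<le> length \<pi>" "patterns xs = patterns \<pi>"
    using assms by (auto simp: \<pi>_def is_perm_standardise patterns_standardise)
  have "\<pi> \<in> patterns \<pi>"
    unfolding patterns_perm[OF \<pi>(1)] perm_le_singleton_iff
    using \<pi>(1,2) perm_le_refl[OF \<pi>(1)] by auto
  moreover have "finite (patterns \<pi>)"
    using \<pi>(1) by (intro finite_patterns is_perm_distinct)
  ultimately have "(\<Sum>\<sigma>\<in>patterns \<pi>. perm_mobius [1] \<sigma>)
      = perm_mobius [1] \<pi> + (\<Sum>\<sigma>\<in>patterns \<pi> - {\<pi>}. perm_mobius [1] \<sigma>)"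
    by (rule sum.remove[rotated])
  then show ?thesis
    using perm_mobius_eq_sum_patterns[OF \<pi>(1,2)] \<pi>(3) by simp
qed

section \<open>Adjacencies\<close>

definition follows :: "'a list \<Rightarrow> 'a \<Rightarrow> 'a \<Rightarrow> bool" where
  "follows xs a b \<longleftrightarrow> (\<exists>us vs. xs = us @ a # b # vs)"

lemma follows_iff_nth:
  "follows xs a b \<longleftrightarrow> (\<exists>i. Suc i < length xs \<and> xs ! i = a \<and> xs ! Suc i = b)"
proof
  assume "follows xs a b"
  then obtain us vs where "xs = us @ a # b # vs"
    by (auto simp: follows_def)
  then show "\<exists>i. Suc i < length xs \<and> xs ! i = a \<and> xs ! Suc i = b"
    by (intro exI[of _ "length us"]) (simp add: nth_append)
next
  assume "\<exists>i. Suc i < length xs \<and> xs ! i = a \<and> xs ! Suc i = b"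
  then obtain i where "Suc i < length xs" "xs ! i = a" "xs ! Suc i = b"
    by blast
  then have "xs = take i xs @ a # b # drop (Suc (Suc i)) xs"
    by (metis Cons_nth_drop_Suc Suc_lessD append_take_drop_id)
  then show "follows xs a b"
    unfolding follows_def by blast
qed

lemma follows_in_set: "follows xs a b \<Longrightarrow> a \<in> set xs \<and> b \<in> set xs"
  by (auto simp: follows_def)

lemma follows_map: "follows xs a b \<Longrightarrow> follows (map f xs) (f a) (f b)"
  unfolding follows_def by (metis list.simps(9) map_append)

lemma follows_unique_right: "distinct xs \<Longrightarrow> follows xs a b \<Longrightarrow> follows xs a c \<Longrightarrow> b = c"
  by (auto simp: follows_iff_nth nth_eq_iff_index_eq)

lemma follows_unique_left: "distinct xs \<Longrightarrow> follows xs a c \<Longrightarrow> follows xs b c \<Longrightarrow> a = b"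
  by (auto simp: follows_iff_nth nth_eq_iff_index_eq)

lemma follows_antisym: "distinct xs \<Longrightarrow> follows xs a b \<Longrightarrow> \<not> follows xs b a"
  by (auto simp: follows_iff_nth nth_eq_iff_index_eq)

lemma subseq_Cons_obtain:
  assumes "subseq ys (a # zs)" "a \<in> set ys" "a \<notin> set zs"
  obtains ys' where "ys = a # ys'" "subseq ys' zs"
proof (cases ys)
  case (Cons x ys')
  have "x = a"
  proof (rule ccontr)
    assume "x \<noteq> a"
    then have "subseq ys zs"
      using assms(1) Cons by simp
    then show False
      using set_subseq assms(2,3) by blast
  qed
  then show thesis
    using that assms(1) Cons by simp
qed (use assms(2) in simp)

lemma follows_subseq:
  assumes "distinct xs" "follows xs a b" "subseq ys xs" "a \<in> set ys" "b \<in> set ys"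
  shows "follows ys a b"
proof -
  obtain us vs where xs: "xs = us @ a # b # vs"
    using assms(2) by (auto simp: follows_def)
  obtain ys1 ys2 where ys: "ys = ys1 @ ys2" "subseq ys1 us" "subseq ys2 (a # b # vs)"
    using assms(3) unfolding xs by (auto elim: subseq_appendE)
  have sets: "set ys1 \<subseteq> set us" "set ys2 \<subseteq> {a, b} \<union> set vs"
    using set_subseq[OF ys(2)] set_subseq[OF ys(3)] by auto
  have ab: "a \<noteq> b" "a \<notin> set us" "a \<notin> set vs" "b \<notin> set us" "b \<notin> set vs"
    using assms(1) by (auto simp: xs)
  have "a \<in> set ys2" "b \<in> set ys2"
    using assms(4,5) ys(1) sets ab by auto
  obtain ys3 where ys3: "ys2 = a # ys3" "subseq ys3 (b # vs)"
    using subseq_Cons_obtain[OF ys(3) \<open>a \<in> set ys2\<close>] ab by auto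
  obtain ys4 where "ys3 = b # ys4"
    using subseq_Cons_obtain[OF ys3(2)] \<open>b \<in> set ys2\<close> ys3(1) ab by auto
  then show ?thesis
    using ys(1) ys3(1) by (auto simp: follows_def)
qed

text \<open>
  The second condition says that \<open>a\<close> and \<open>b\<close> are consecutive among the values present in the
  list, so that the notion is invariant under order isomorphism and passes to sublists.
\<close>

definition adjacency :: "nat list \<Rightarrow> nat \<Rightarrow> nat \<Rightarrow> bool" where
  "adjacency xs a b \<longleftrightarrow> follows xs a b \<and> (\<forall>c\<in>set xs. \<not> (min a b < c \<and> c < max a b))"

definition opposing :: "nat list \<Rightarrow> bool" where
  "opposing xs \<longleftrightarrow> (\<exists>a b. adjacency xs a b \<and> a < b) \<and> (\<exists>c d. adjacency xs c d \<and> d < c)"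

lemma adjacency_subseq:
  assumes "distinct xs" "adjacency xs a b" "subseq ys xs" "a \<in> set ys" "b \<in> set ys"
  shows "adjacency ys a b"
  using assms follows_subseq[OF assms(1) _ assms(3-5)] set_subseq[OF assms(3)]
  unfolding adjacency_def by blast

lemma adjacency_map:
  assumes f: "strict_mono_on (set xs) f" and adj: "adjacency xs a b"
  shows "adjacency (map f xs) (f a) (f b)" "f a < f b \<longleftrightarrow> a < b" "f b < f a \<longleftrightarrow> b < a"
proof -
  have ab: "a \<in> set xs" "b \<in> set xs"
    using adj by (auto simp: adjacency_def dest: follows_in_set)
  have less: "f x < f y \<longleftrightarrow> x < y" if "x \<in> set xs" "y \<in> set xs" for x y
    using strict_mono_on_less[OF f that] .
  show "f a < f b \<longleftrightarrow> a < b" "f b < f a \<longleftrightarrow> b < a"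
    using ab less by auto
  show "adjacency (map f xs) (f a) (f b)"
    using adj ab less by (auto simp: adjacency_def follows_map min_less_iff_disj less_max_iff_disj)
qed

text \<open>
  A pattern occurrence through both entries of an adjacency inherits it: nothing can get in between
  two neighbours by passing to a sublist.
\<close>

lemma adjacency_in_pattern:
  assumes "distinct xs" "subseq ys xs" "order_isomorphic \<sigma> ys"
    and "adjacency xs a b" "a \<in> set ys" "b \<in> set ys"
  obtains a' b' where "adjacency \<sigma> a' b'" "a' < b' \<longleftrightarrow> a < b" "b' < a' \<longleftrightarrow> b < a"
proof -
  obtain f where f: "strict_mono_on (set ys) f" "\<sigma> = map f ys"
    using order_isomorphic_sym[OF assms(3)] by (rule order_isomorphic_obtain_map)
  have "adjacency ys a b"
    using assms(1,4,2,5,6) by (rule adjacency_subseq)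
  with f show thesis
    by (intro that[of "f a" "f b"]) (auto simp: adjacency_map)
qed

text \<open>
  Within an adjacency the two entries are interchangeable. An occurrence that uses only one of them
  may be moved to the other, so it survives the deletion of \<open>a\<close>.
\<close>

lemma contains_removeAll_of_adjacency:
  assumes xs: "distinct xs" "adjacency xs a b" and ys: "subseq ys xs" "order_isomorphic \<sigma> ys"
    and omit: "a \<notin> set ys \<or> b \<notin> set ys"
  shows "contains \<sigma> (removeAll a xs)"
proof (cases "a \<in> set ys")
  case False
  then have "subseq ys (removeAll a xs)"
    using subseq_filter[OF ys(1), of "\<lambda>x. a \<noteq> x"]
    by (metis removeAll_filter_not_eq removeAll_id)
  then show ?thesis
    using ys(2) by (auto simp: contains_def)
next
  case True
  then have b: "b \<notin> set ys"
    using omit by simp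
  obtain us vs where dec: "xs = us @ a # b # vs"
    using xs(2) by (auto simp: adjacency_def follows_def)
  \<comment> \<open>The occurrence uses \<open>a\<close> but not \<open>b\<close>, and \<open>f\<close> moves it from \<open>a\<close> to \<open>b\<close>.\<close>
  define f where "f = id(a := b)"
  have "subseq ys (removeAll b xs)"
    using subseq_filter[OF ys(1), of "\<lambda>x. b \<noteq> x"] b
    by (metis removeAll_filter_not_eq removeAll_id)
  then have "subseq ys (us @ a # vs)"
    using xs(1) by (auto simp: dec)
  then have "subseq (map f ys) (map f (us @ a # vs))"
    by (rule subseq_map)
  also have "map f (us @ a # vs) = removeAll a xs"
    using xs(1) by (auto simp: dec f_def)
  finally have "subseq (map f ys) (removeAll a xs)" .
  moreover have "strict_mono_on (set ys) f"
  proof (rule strict_mono_onI)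
    fix x y assume xy: "x \<in> set ys" "y \<in> set ys" "x < y"
    have "x \<in> set xs" "y \<in> set xs"
      using xy set_subseq[OF ys(1)] by auto
    then have "\<not> (min a b < x \<and> x < max a b)" "\<not> (min a b < y \<and> y < max a b)"
      using xs(2) by (auto simp: adjacency_def)
    moreover have "x \<noteq> b" "y \<noteq> b"
      using xy b by auto
    ultimately show "f x < f y"
      using xy(3) by (auto simp: f_def)
  qed
  ultimately show ?thesis
    using order_isomorphic_trans[OF ys(2) order_isomorphic_map] unfolding contains_def by blast
qed

lemma pattern_of_adjacency:
  assumes "distinct xs" "adjacency xs a b" "contains \<sigma> xs" "\<not> contains \<sigma> (removeAll a xs)"
  shows "\<exists>a' b'. adjacency \<sigma> a' b' \<and> (a' < b' \<longleftrightarrow> a < b) \<and> (b' < a' \<longleftrightarrow> b < a)"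
proof -
  obtain ys where ys: "subseq ys xs" "order_isomorphic \<sigma> ys"
    using assms(3) unfolding contains_def by blast
  have "a \<in> set ys" "b \<in> set ys"
    using contains_removeAll_of_adjacency[OF assms(1,2) ys] assms(4) by auto
  then show ?thesis
    using adjacency_in_pattern[OF assms(1) ys assms(2)] by metis
qed

lemma subseq_removeAll: "subseq (removeAll a xs) xs"
  by (metis removeAll_filter_not_eq subseq_filter_left)

text \<open>
  Two adjacencies of opposite directions cannot share an entry, so collapsing one of them leaves the
  other intact.
\<close>

lemma opposing_disjoint:
  assumes "distinct xs" "adjacency xs a b" "a < b" "adjacency xs c d" "d < c"
  shows "a \<noteq> c" "b \<noteq> d" "a \<noteq> d" "b \<noteq> c"
proof -
  have f: "follows xs a b" "follows xs c d"
    using assms by (auto simp: adjacency_def)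
  have mem: "a \<in> set xs" "b \<in> set xs" "c \<in> set xs" "d \<in> set xs"
    using f follows_in_set by metis+
  show "a \<noteq> c" "b \<noteq> d"
    using f assms(3,5) follows_unique_right[OF assms(1)] follows_unique_left[OF assms(1)]
    by (metis less_asym)+
  have gap: "\<not> (a < x \<and> x < b)" "\<not> (d < x \<and> x < c)" if "x \<in> set xs" for x
    using assms that by (auto simp: adjacency_def)
  show "a \<noteq> d"
    using gap(2)[OF mem(2)] gap(1)[OF mem(3)] assms(3,5) f follows_antisym[OF assms(1)]
    by (metis linorder_neqE_nat)
  show "b \<noteq> c"
    using gap(2)[OF mem(1)] gap(1)[OF mem(4)] assms(3,5) f follows_antisym[OF assms(1)]
    by (metis linorder_neqE_nat)
qed

section \<open>Opposing adjacencies annihilate the Moebius function\<close>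

text \<open>
  The two collapsed permutations \<open>P\<close> and \<open>Q\<close> cover, up to patterns whose Moebius value vanishes
  by induction, everything strictly below \<open>\<pi>\<close>, and they meet, up to such patterns, exactly in
  the interval below \<open>R\<close>.
\<close>

lemma perm_mobius_opposing:
  assumes "is_perm \<pi>" "opposing \<pi>"
  shows "perm_mobius [1] \<pi> = 0"
  using assms
proof (induction \<pi> rule: length_induct)
  case (1 \<pi>)
  let ?\<mu> = "perm_mobius [1]"
  have dist: "distinct \<pi>"
    using 1 is_perm_distinct by blast
  obtain a b c d where up: "adjacency \<pi> a b" "a < b" and down: "adjacency \<pi> c d" "d < c"
    using 1 by (auto simp: opposing_def)
  have disj: "a \<noteq> c" "b \<noteq> d" "a \<noteq> d" "b \<noteq> c"
    using opposing_disjoint[OF dist up down] .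
  have mem: "a \<in> set \<pi>" "b \<in> set \<pi>" "c \<in> set \<pi>" "d \<in> set \<pi>"
    using up down by (auto simp: adjacency_def dest: follows_in_set)
  define P where "P = removeAll a \<pi>"
  define Q where "Q = removeAll c \<pi>"
  define R where "R = removeAll a Q"
  have R_alt: "R = removeAll c P"
    by (simp add: R_def P_def Q_def removeAll_filter_not_eq conj_commute)
  have dists: "distinct P" "distinct Q" "distinct R"
    using dist by (auto simp: P_def Q_def R_def distinct_removeAll)
  have subs: "subseq P \<pi>" "subseq Q \<pi>" "subseq R P" "subseq R Q"
    using subseq_removeAll[of a Q] subseq_removeAll[of c P] subseq_removeAll[of _ \<pi>]
    unfolding R_alt[symmetric] R_def[symmetric] unfolding P_def Q_def by blast+
  have setR: "{b, d} \<subseteq> set R"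
    using mem disj up down by (auto simp: R_def Q_def)
  \<comment> \<open>The entries \<open>b\<close> and \<open>d\<close> survive all deletions, so every list has length at least two.\<close>
  have two: "2 \<le> length xs" if "{b, d} \<subseteq> set xs" for xs
    using card_mono[OF _ that] card_length[of xs] disj by auto
  have lens: "2 \<le> length P" "2 \<le> length Q" "2 \<le> length R" "2 \<le> length \<pi>"
    using setR subs[THEN set_subseq] by (blast intro: two)+
  have short: "length P < length \<pi>" "length Q < length \<pi>"
    using mem by (auto simp: P_def Q_def length_removeAll_less)
  have adjQ: "adjacency Q a b" and adjP: "adjacency P c d"
    using adjacency_subseq[OF dist up(1) subs(2)] adjacency_subseq[OF dist down(1) subs(1)] disj mem
    by (auto simp: P_def Q_def)
  have PQ: "patterns P \<subseteq> patterns \<pi> - {\<pi>}" "patterns Q \<subseteq> patterns \<pi> - {\<pi>}"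
    using subs short contains_mono[of _ P \<pi>] contains_mono[of _ Q \<pi>]
      contains_length[of \<pi> P] contains_length[of \<pi> Q] by (auto simp: patterns_def)
  have RPQ: "patterns R \<subseteq> patterns P \<inter> patterns Q"
    using contains_mono[OF _ subs(3)] contains_mono[OF _ subs(4)] by (auto simp: patterns_def)
  have fin: "finite (patterns \<pi>)" "finite (patterns P)" "finite (patterns Q)"
    using dist dists by (auto intro: finite_patterns)
  have IH: "?\<mu> \<sigma> = 0" if "\<sigma> \<in> patterns \<pi>" "\<sigma> \<noteq> \<pi>" "opposing \<sigma>" for \<sigma>
  proof -
    have "perm_less \<sigma> \<pi>"
      using that 1 by (auto simp: patterns_def perm_less_def perm_le_iff_contains)
    then show ?thesis
      using 1 that perm_less_length by (auto simp: patterns_def)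
  qed
  \<comment> \<open>\<open>\<sigma>\<close> needs both entries of both adjacencies of \<open>\<pi>\<close>.\<close>
  have outside: "?\<mu> \<sigma> = 0" if "\<sigma> \<in> patterns \<pi> - {\<pi>} - (patterns P \<union> patterns Q)" for \<sigma>
  proof -
    have \<sigma>: "is_perm \<sigma>" "contains \<sigma> \<pi>" "\<not> contains \<sigma> P" "\<not> contains \<sigma> Q"
      using that by (auto simp: patterns_def)
    have "opposing \<sigma>"
      unfolding opposing_def
      using pattern_of_adjacency[OF dist up(1) \<sigma>(2)] pattern_of_adjacency[OF dist down(1) \<sigma>(2)]
        up(2) down(2) \<sigma>(3,4) by (auto simp: P_def Q_def)
    then show ?thesis
      using IH that by auto
  qed
  \<comment> \<open>An occurrence in \<open>P\<close> must use the remaining down-adjacency, one in \<open>Q\<close> the up-adjacency.\<close>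
  have inside: "?\<mu> \<sigma> = 0" if "\<sigma> \<in> patterns P \<inter> patterns Q - patterns R" for \<sigma>
  proof -
    have \<sigma>: "is_perm \<sigma>" "contains \<sigma> P" "contains \<sigma> Q" "\<not> contains \<sigma> R"
      using that by (auto simp: patterns_def)
    have "opposing \<sigma>"
      unfolding opposing_def
      using pattern_of_adjacency[OF dists(1) adjP \<sigma>(2)] pattern_of_adjacency[OF dists(2) adjQ \<sigma>(3)]
        up(2) down(2) \<sigma>(4) by (auto simp flip: R_def R_alt)
    then show ?thesis
      using IH that PQ by auto
  qed
  have "(\<Sum>\<sigma>\<in>patterns \<pi> - {\<pi>}. ?\<mu> \<sigma>) = (\<Sum>\<sigma>\<in>patterns P \<union> patterns Q. ?\<mu> \<sigma>)"
    using fin PQ outside by (intro sum.mono_neutral_right) auto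
  also have "\<dots> = (\<Sum>\<sigma>\<in>patterns P. ?\<mu> \<sigma>) + (\<Sum>\<sigma>\<in>patterns Q. ?\<mu> \<sigma>)
      - (\<Sum>\<sigma>\<in>patterns P \<inter> patterns Q. ?\<mu> \<sigma>)"
    using fin by (intro sum_Un) auto
  also have "(\<Sum>\<sigma>\<in>patterns P \<inter> patterns Q. ?\<mu> \<sigma>) = (\<Sum>\<sigma>\<in>patterns R. ?\<mu> \<sigma>)"
    using fin RPQ inside by (intro sum.mono_neutral_right) auto
  finally have "(\<Sum>\<sigma>\<in>patterns \<pi> - {\<pi>}. ?\<mu> \<sigma>) = 0"
    using dists lens by (simp add: sum_perm_mobius_patterns)
  then show ?case
    using perm_mobius_eq_sum_patterns[of \<pi>] 1 lens by simp
qed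

section \<open>Counting permutations with prescribed adjacencies\<close>

lemma follows_removeAll:
  assumes "follows xs a b" "c \<noteq> a" "c \<noteq> b"
  shows "follows (removeAll c xs) a b"
proof -
  obtain us vs where "xs = us @ a # b # vs"
    using assms(1) by (auto simp: follows_def)
  then have "removeAll c xs = removeAll c us @ a # b # removeAll c vs"
    using assms(2,3) by simp
  then show ?thesis
    unfolding follows_def by blast
qed

text \<open>
  The inverse of deleting one entry of an adjacency: \<open>b\<close> is put immediately after \<open>a\<close> if
  \<open>d\<close> holds, and immediately before it otherwise. The same coding of directions (true for up) is
  used below.
\<close>

definition insert_beside :: "bool \<Rightarrow> 'a \<Rightarrow> 'a \<Rightarrow> 'a list \<Rightarrow> 'a list" where
  "insert_beside d a b xs =
     concat (map (\<lambda>x. if x = a then (if d then [a, b] else [b, a]) else [x]) xs)"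

lemma insert_beside_append [simp]:
  "insert_beside d a b (xs @ ys) = insert_beside d a b xs @ insert_beside d a b ys"
  by (simp add: insert_beside_def)

lemma insert_beside_Cons [simp]:
  "insert_beside d a b (x # xs) =
     (if x = a then (if d then [a, b] else [b, a]) else [x]) @ insert_beside d a b xs"
  by (simp add: insert_beside_def)

lemma insert_beside_id: "a \<notin> set xs \<Longrightarrow> insert_beside d a b xs = xs"
  by (induction xs) (auto simp: insert_beside_def)

lemma follows_insert_beside:
  assumes "follows xs x y" "x \<noteq> a" "y \<noteq> a"
  shows "follows (insert_beside d a b xs) x y"
proof -
  obtain us vs where "xs = us @ x # y # vs"
    using assms(1) by (auto simp: follows_def)
  then have "insert_beside d a b xs = insert_beside d a b us @ x # y # insert_beside d a b vs"
    using assms(2,3) by simp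
  then show ?thesis
    unfolding follows_def by blast
qed

definition next_to :: "bool \<Rightarrow> 'a list \<Rightarrow> 'a \<Rightarrow> 'a \<Rightarrow> bool" where
  "next_to d xs a b \<longleftrightarrow> (if d then follows xs a b else follows xs b a)"

lemma insert_beside_perm:
  assumes "xs \<in> permutations_of_set W" "a \<in> W" "b \<notin> W"
  shows "insert_beside d a b xs \<in> permutations_of_set (insert b W)"
    and "removeAll b (insert_beside d a b xs) = xs"
    and "next_to d (insert_beside d a b xs) a b"
proof -
  have xs: "set xs = W" "distinct xs"
    using assms(1) by (auto simp: permutations_of_set_def)
  then obtain us vs where dec: "xs = us @ a # vs"
    using assms(2) by (metis split_list)
  have "insert_beside d a b xs = us @ (if d then [a, b] else [b, a]) @ vs"
    using xs(2) by (simp add: dec insert_beside_id)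
  then show "insert_beside d a b xs \<in> permutations_of_set (insert b W)"
    and "removeAll b (insert_beside d a b xs) = xs"
    and "next_to d (insert_beside d a b xs) a b"
    using xs assms(2,3) by (auto simp: dec permutations_of_set_def next_to_def follows_def)
qed

lemma removeAll_perm:
  assumes "xs \<in> permutations_of_set W"
  shows "removeAll b xs \<in> permutations_of_set (W - {b})"
  using assms by (auto simp: permutations_of_set_def distinct_removeAll)

lemma insert_beside_removeAll:
  assumes "distinct xs" "next_to d xs a b"
  shows "insert_beside d a b (removeAll b xs) = xs"
proof -
  define ps where "ps = (if d then [a, b] else [b, a])"
  obtain us vs where dec: "xs = us @ ps @ vs"
    using assms(2) by (auto simp: next_to_def follows_def ps_def split: if_splits)
  have "a \<noteq> b" "removeAll b xs = us @ a # vs" "a \<notin> set us" "a \<notin> set vs"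
    using assms(1) by (auto simp: dec ps_def split: if_splits)
  then show ?thesis
    by (simp add: insert_beside_id dec ps_def)
qed

text \<open>
  Here \<open>T\<close> is the set of admissible directions; treating it as a parameter covers the up-adjacencies,
  the down-adjacencies and both together by one count.
\<close>

definition beside :: "bool set \<Rightarrow> nat list \<Rightarrow> nat \<Rightarrow> bool" where
  "beside T xs v \<longleftrightarrow> (\<exists>d\<in>T. next_to d xs v (Suc v))"

text \<open>
  The ground set \<open>W\<close> need not be an initial segment, because the count below proceeds by deleting
  values.
\<close>

definition aligned :: "bool set \<Rightarrow> nat set \<Rightarrow> nat set \<Rightarrow> nat list set" where
  "aligned T W V = {xs \<in> permutations_of_set W. \<forall>v\<in>V. beside T xs v}"

lemma finite_aligned: "finite (aligned T W V)"
  by (simp add: aligned_def)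

lemma inj_on_insert_beside:
  assumes "a \<in> W" "b \<notin> W"
  shows "inj_on (\<lambda>(d, xs). insert_beside d a b xs) (T \<times> permutations_of_set W)"
proof (rule inj_onI, clarify)
  fix d xs e ys
  assume mem: "xs \<in> permutations_of_set W" "ys \<in> permutations_of_set W"
    and eq: "insert_beside d a b xs = insert_beside e a b ys"
  have "distinct (insert_beside d a b xs)"
    using insert_beside_perm(1)[OF mem(1) assms, of d] by (simp add: permutations_of_set_def)
  moreover have "next_to d (insert_beside d a b xs) a b" "next_to e (insert_beside d a b xs) a b"
    using insert_beside_perm(3)[OF mem(1) assms, of d] insert_beside_perm(3)[OF mem(2) assms, of e]
    by (simp_all add: eq)
  ultimately have "d = e"
    using follows_antisym[of "insert_beside d a b xs" a b]
    by (auto simp: next_to_def split: if_splits)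
  moreover have "xs = ys"
    using insert_beside_perm(2)[OF mem(1) assms, of d] insert_beside_perm(2)[OF mem(2) assms, of e]
      eq by simp
  ultimately show "d = e \<and> xs = ys"
    by simp
qed

text \<open>
  If \<open>v\<close> exceeds all of \<open>V\<close>, deleting \<open>v + 1\<close> leaves the conditions indexed by \<open>V\<close> alone, since they
  concern only values up to \<open>v\<close>. The deleted value can be put back once a direction in \<open>T\<close> is
  known.
\<close>

lemma aligned_insert_subset:
  assumes "\<forall>u\<in>V. u < v"
  shows "aligned T W (insert v V)
     \<subseteq> (\<lambda>(d, xs). insert_beside d v (Suc v) xs) ` (T \<times> aligned T (W - {Suc v}) V)"
proof
  fix xs assume xs: "xs \<in> aligned T W (insert v V)"
  then obtain d where d: "d \<in> T" "next_to d xs v (Suc v)"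
    by (auto simp: aligned_def beside_def)
  let ?ys = "removeAll (Suc v) xs"
  have "beside T ?ys u" if "u \<in> V" for u
  proof -
    have "u < v"
      using assms that by blast
    moreover have "beside T xs u"
      using xs that by (simp add: aligned_def)
    then obtain e where "e \<in> T" "next_to e xs u (Suc u)"
      unfolding beside_def by (elim bexE)
    ultimately show ?thesis
      by (auto simp: beside_def next_to_def follows_removeAll intro!: bexI[of _ e])
  qed
  then have "?ys \<in> aligned T (W - {Suc v}) V"
    using xs removeAll_perm by (auto simp: aligned_def)
  moreover have "xs = insert_beside d v (Suc v) ?ys"
    using xs d(2) by (intro insert_beside_removeAll[symmetric])
      (auto simp: aligned_def permutations_of_set_def)
  ultimately show "xs \<in> (\<lambda>(d, xs). insert_beside d v (Suc v) xs) ` (T \<times> aligned T (W - {Suc v}) V)"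
    using d(1) by (intro image_eqI[of _ _ "(d, ?ys)"]) auto
qed

text \<open>
  Conversely, inserting \<open>v + 1\<close> next to \<open>v\<close> separates only \<open>v\<close> from a neighbour. This is harmless unless
  the neighbour is required to be \<open>v - 1\<close>, which the first hypothesis excludes.
\<close>

lemma aligned_insert_superset:
  assumes "\<forall>u\<in>V. Suc u < v" "v \<in> W" "Suc v \<in> W"
  shows "(\<lambda>(d, xs). insert_beside d v (Suc v) xs) ` (T \<times> aligned T (W - {Suc v}) V)
     \<subseteq> aligned T W (insert v V)"
proof clarify
  fix d xs assume d: "d \<in> T" and xs: "xs \<in> aligned T (W - {Suc v}) V"
  let ?ys = "insert_beside d v (Suc v) xs"
  have perm: "xs \<in> permutations_of_set (W - {Suc v})" "v \<in> W - {Suc v}" "Suc v \<notin> W - {Suc v}"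
    using xs assms by (auto simp: aligned_def)
  have "beside T ?ys u" if "u \<in> V" for u
  proof -
    have "Suc u < v"
      using assms that by blast
    moreover have "beside T xs u"
      using xs that by (simp add: aligned_def)
    then obtain e where "e \<in> T" "next_to e xs u (Suc u)"
      unfolding beside_def by (elim bexE)
    ultimately show ?thesis
      by (auto simp: beside_def next_to_def follows_insert_beside intro!: bexI[of _ e])
  qed
  moreover have "beside T ?ys v"
    using d insert_beside_perm(3)[OF perm] by (auto simp: beside_def)
  moreover have "?ys \<in> permutations_of_set W"
    using insert_beside_perm(1)[OF perm, of d] assms(3) by (simp add: insert_absorb)
  ultimately show "?ys \<in> aligned T W (insert v V)"
    by (auto simp: aligned_def)
qed

text \<open>
  Each \<open>v\<close> in \<open>V\<close>, taken in decreasing order, removes one value and contributes at most one factor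
  \<open>card T\<close>. Consecutive elements of \<open>V\<close> may force incompatible directions, and then the bound is
  not attained.
\<close>

lemma card_aligned:
  assumes "finite V" "finite W" "V \<union> Suc ` V \<subseteq> W"
  shows "card (aligned T W V) \<le> card T ^ card V * fact (card W - card V)"
    and "(\<forall>v\<in>V. Suc v \<notin> V) \<Longrightarrow>
      card (aligned T W V) = card T ^ card V * fact (card W - card V)"
proof -
  have "card (aligned T W V) \<le> card T ^ card V * fact (card W - card V) \<and>
      ((\<forall>v\<in>V. Suc v \<notin> V) \<longrightarrow> card (aligned T W V) = card T ^ card V * fact (card W - card V))"
    using assms
  proof (induction V arbitrary: W rule: finite_linorder_max_induct)
    case empty
    then show ?case
      by (simp add: aligned_def)
  next
    case (insert v V)
    let ?W = "W - {Suc v}"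
    let ?f = "\<lambda>(d, xs). insert_beside d v (Suc v) xs"
    have W: "finite ?W" "V \<union> Suc ` V \<subseteq> ?W" "v \<in> ?W" "Suc v \<notin> ?W" "Suc v \<in> W" "v \<in> W"
      using insert.prems insert.hyps by auto
    have v: "v \<notin> V"
      using insert.hyps by auto
    have le: "card (aligned T ?W V) \<le> card T ^ card V * fact (card ?W - card V)"
      and eq: "(\<forall>v\<in>V. Suc v \<notin> V) \<Longrightarrow>
        card (aligned T ?W V) = card T ^ card V * fact (card ?W - card V)"
      using insert.IH[OF W(1,2)] by auto
    have cards: "card ?W - card V = card W - card (insert v V)"
      using insert.hyps(1) v insert.prems(1) W(5) by simp
    have fin: "finite (T \<times> aligned T ?W V)"
      by (simp add: finite_aligned)
    have "card (aligned T W (insert v V)) \<le> card (?f ` (T \<times> aligned T ?W V))"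
      using fin insert.hyps(2) by (intro card_mono aligned_insert_subset finite_imageI) auto
    also have "\<dots> \<le> card (T \<times> aligned T ?W V)"
      using fin by (rule card_image_le)
    also have "\<dots> \<le> card T * (card T ^ card V * fact (card ?W - card V))"
      using le by (simp add: card_cartesian_product)
    finally have upper: "card (aligned T W (insert v V))
        \<le> card T ^ card (insert v V) * fact (card W - card (insert v V))"
      using insert.hyps(1) v cards by simp
    moreover have "card (aligned T W (insert v V))
        = card T ^ card (insert v V) * fact (card W - card (insert v V))"
      if sep: "\<forall>u\<in>insert v V. Suc u \<notin> insert v V"
    proof -
      have "\<forall>u\<in>V. Suc u < v"
        using sep insert.hyps(2) by (metis insertCI le_neq_implies_less less_eq_Suc_le)
      then have "aligned T W (insert v V) = ?f ` (T \<times> aligned T ?W V)"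
        using insert.hyps(2) W(5,6) by (intro equalityI aligned_insert_subset aligned_insert_superset) auto
      moreover have "inj_on ?f (T \<times> aligned T ?W V)"
        by (rule inj_on_subset[OF inj_on_insert_beside[OF W(3,4), of T]]) (auto simp: aligned_def)
      ultimately have "card (aligned T W (insert v V)) = card (T \<times> aligned T ?W V)"
        by (simp add: card_image)
      also have "\<dots> = card T * (card T ^ card V * fact (card ?W - card V))"
        using eq sep by (simp add: card_cartesian_product)
      finally show ?thesis
        using insert.hyps(1) v cards by simp
    qed
    ultimately show ?case
      by blast
  qed
  then show "card (aligned T W V) \<le> card T ^ card V * fact (card W - card V)"
    and "(\<forall>v\<in>V. Suc v \<notin> V) \<Longrightarrow>
      card (aligned T W V) = card T ^ card V * fact (card W - card V)"
    by auto
qed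

section \<open>The probability of having no adjacency\<close>

text \<open>
  Inclusion-exclusion, obtained by expanding the product of \<open>1 - [P v x]\<close> over \<open>v \<in> I\<close>.
\<close>

lemma card_avoid_all:
  assumes "finite \<Omega>" "finite I"
  shows "real (card {x \<in> \<Omega>. \<forall>v\<in>I. \<not> P v x})
    = (\<Sum>V\<in>Pow I. (-1) ^ card V * real (card {x \<in> \<Omega>. \<forall>v\<in>V. P v x}))"
proof -
  have prod: "(\<Prod>v\<in>V. of_bool (Q v)) = (of_bool (\<forall>v\<in>V. Q v) :: real)" if "V \<subseteq> I" for V Q
    using finite_subset[OF that assms(2)] by (induction V rule: finite_induct) auto
  have card: "real (card {x \<in> \<Omega>. Q x}) = (\<Sum>x\<in>\<Omega>. of_bool (Q x))" for Q
    using assms(1) by (simp add: Int_def)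
  have "of_bool (\<forall>v\<in>I. \<not> P v x) = (\<Sum>V\<in>Pow I. (-1) ^ card V * of_bool (\<forall>v\<in>V. P v x) :: real)" for x
  proof -
    have "of_bool (\<forall>v\<in>I. \<not> P v x) = (\<Prod>v\<in>I. 1 - of_bool (P v x) :: real)"
      by (simp add: prod[OF order_refl, symmetric] of_bool_not_iff)
    also have "\<dots> = (\<Sum>V\<in>Pow I. (-1) ^ card V * (\<Prod>v\<in>V. of_bool (P v x)))"
      by (simp add: prod_diff_conv_sum[OF assms(2)])
    also have "\<dots> = (\<Sum>V\<in>Pow I. (-1) ^ card V * of_bool (\<forall>v\<in>V. P v x))"
      by (intro sum.cong refl) (simp add: prod)
    finally show ?thesis .
  qed
  then have "real (card {x \<in> \<Omega>. \<forall>v\<in>I. \<not> P v x})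
      = (\<Sum>x\<in>\<Omega>. \<Sum>V\<in>Pow I. (-1) ^ card V * of_bool (\<forall>v\<in>V. P v x))"
    by (simp only: card)
  also have "\<dots> = (\<Sum>V\<in>Pow I. (-1) ^ card V * (\<Sum>x\<in>\<Omega>. of_bool (\<forall>v\<in>V. P v x)))"
    by (subst sum.swap) (simp only: sum_distrib_left)
  finally show ?thesis
    by (simp only: card)
qed

lemma sum_Pow_card:
  fixes g :: "nat \<Rightarrow> 'a::comm_semiring_1"
  assumes "finite I"
  shows "(\<Sum>V\<in>Pow I. g (card V)) = (\<Sum>k\<le>card I. of_nat (card I choose k) * g k)"
proof -
  have "(\<Sum>V\<in>Pow I. g (card V)) = (\<Sum>k\<le>card I. \<Sum>V\<in>{V \<in> Pow I. card V = k}. g (card V))"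
    using assms by (intro sum.group[symmetric]) (auto intro: card_mono)
  also have "\<dots> = (\<Sum>k\<le>card I. of_nat (card I choose k) * g k)"
  proof (rule sum.cong[OF refl])
    fix k
    have "(\<Sum>V\<in>{V \<in> Pow I. card V = k}. g (card V)) = (\<Sum>V\<in>{V \<in> Pow I. card V = k}. g k)"
      by (rule sum.cong) auto
    then show "(\<Sum>V\<in>{V \<in> Pow I. card V = k}. g (card V)) = of_nat (card I choose k) * g k"
      using n_subsets[OF assms, of k] by simp
  qed
  finally show ?thesis .
qed

lemma choose_fact_eq:
  assumes "k \<le> N"
  shows "real (N choose k) * fact (Suc N - k) = fact N * real (Suc N - k) / fact k"
proof -
  have "real (N choose k) = fact N / (fact k * fact (N - k))"
    using assms by (rule binomial_fact)
  moreover have "fact (Suc N - k) = real (Suc N - k) * fact (N - k)"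
    using assms by (simp add: Suc_diff_le)
  ultimately show ?thesis
    by (simp add: field_simps)
qed

lemma exp_partial_sum_le:
  fixes x :: real
  assumes "0 \<le> x"
  shows "(\<Sum>k\<le>N. x ^ k / fact k) \<le> exp x"
proof -
  have "(\<lambda>k. x ^ k / fact k) sums exp x"
    using exp_converges[of x] by (simp add: scaleR_conv_of_real field_simps)
  then show ?thesis
    using sum_le_suminf[of "\<lambda>k. x ^ k / fact k" "{..N}"] assms by (simp add: sums_iff)
qed

text \<open>
  Removing \<open>v\<close> and \<open>v + 1\<close> from \<open>V\<close> leaves an arbitrary subset of \<open>n - 3\<close> values. The subsets
  of size \<open>k\<close> have total weight at most \<open>(n - 2)! * m ^ (k + 2) / k!\<close>, which gives a partial sum
  of the exponential series.
\<close>

lemma sum_weight_consecutive_le: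
  assumes "1 \<le> v" "Suc v < n"
  shows "(\<Sum>V | V \<subseteq> {1..<n} \<and> v \<in> V \<and> Suc v \<in> V. real m ^ card V * fact (n - card V))
    \<le> real m ^ 2 * exp (real m) * fact (n - 2)"
proof -
  let ?I = "{1..<n} - {v, Suc v}" and ?h = "\<lambda>U. insert v (insert (Suc v) U)"
  have I: "finite ?I" "card ?I = n - 3"
    using assms by (auto simp: card_Diff_subset)
  have card_h: "card (?h U) = card U + 2" if "U \<subseteq> ?I" for U
  proof -
    have "finite U" "v \<notin> U" "Suc v \<notin> U"
      using finite_subset[OF that] that by auto
    then show ?thesis
      by simp
  qed
  have "(\<Sum>V | V \<subseteq> {1..<n} \<and> v \<in> V \<and> Suc v \<in> V. real m ^ card V * fact (n - card V))
      = (\<Sum>U\<in>Pow ?I. real m ^ card (?h U) * fact (n - card (?h U)))"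
  proof (rule sum.reindex_bij_witness[of _ ?h "\<lambda>V. V - {v, Suc v}"])
    fix V assume "V \<in> {V. V \<subseteq> {1..<n} \<and> v \<in> V \<and> Suc v \<in> V}"
    then show h: "?h (V - {v, Suc v}) = V"
      by blast
    then show "real m ^ card (?h (V - {v, Suc v})) * fact (n - card (?h (V - {v, Suc v})))
        = real m ^ card V * fact (n - card V)"
      by (simp only:)
  qed (use assms in auto)
  also have "\<dots> = (\<Sum>U\<in>Pow ?I. real m ^ (card U + 2) * fact (n - (card U + 2)))"
    using card_h by (intro sum.cong) auto
  also have "\<dots> = (\<Sum>k\<le>n - 3. real ((n - 3) choose k) * (real m ^ (k + 2) * fact (n - (k + 2))))"
    using sum_Pow_card[OF I(1), of "\<lambda>k. real m ^ (k + 2) * fact (n - (k + 2))"] I(2) by simp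
  also have "\<dots> \<le> (\<Sum>k\<le>n - 3. real m ^ 2 * fact (n - 2) * (real m ^ k / fact k))"
  proof (rule sum_mono)
    fix k assume k: "k \<in> {..n - 3}"
    have n: "n - (k + 2) = Suc (n - 3) - k" "fact (n - 2) = real (n - 2) * fact (n - 3)"
      using assms k by (auto simp: fact_reduce numeral_eq_Suc)
    have "real ((n - 3) choose k) * (real m ^ (k + 2) * fact (n - (k + 2)))
        = real m ^ (k + 2) * (real ((n - 3) choose k) * fact (n - (k + 2)))"
      by (rule mult.left_commute)
    also have "real ((n - 3) choose k) * fact (n - (k + 2)) = fact (n - 3) * real (Suc (n - 3) - k) / fact k"
      unfolding n(1) using k by (intro choose_fact_eq) simp
    also have "real m ^ (k + 2) * (fact (n - 3) * real (Suc (n - 3) - k) / fact k)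
        \<le> real m ^ (k + 2) * (fact (n - 3) * real (n - 2) / fact k)"
      using assms by (intro mult_left_mono divide_right_mono) auto
    finally show "real ((n - 3) choose k) * (real m ^ (k + 2) * fact (n - (k + 2)))
        \<le> real m ^ 2 * fact (n - 2) * (real m ^ k / fact k)"
      using n(2) by (simp add: power_add power2_eq_square mult_ac)
  qed
  also have "\<dots> = real m ^ 2 * fact (n - 2) * (\<Sum>k\<le>n - 3. real m ^ k / fact k)"
    by (simp only: sum_distrib_left)
  also have "\<dots> \<le> real m ^ 2 * fact (n - 2) * exp (real m)"
    by (intro mult_left_mono exp_partial_sum_le) auto
  finally show ?thesis
    by (simp add: mult_ac)
qed

lemma sum_UN_le:
  fixes f :: "'a \<Rightarrow> real"
  assumes "finite I" "\<And>i. i \<in> I \<Longrightarrow> finite (A i)" "\<And>x. 0 \<le> f x"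
  shows "sum f (\<Union>i\<in>I. A i) \<le> (\<Sum>i\<in>I. sum f (A i))"
  using assms(1,2)
proof (induction I rule: finite_induct)
  case (insert i I)
  have "sum f (\<Union>j\<in>insert i I. A j) = sum f (A i) + sum f (\<Union>j\<in>I. A j) - sum f (A i \<inter> (\<Union>j\<in>I. A j))"
    using insert by (simp add: sum_Un)
  also have "\<dots> \<le> sum f (A i) + (\<Sum>j\<in>I. sum f (A j))"
    using insert sum_nonneg[of "A i \<inter> (\<Union>j\<in>I. A j)" f] assms(3) by auto
  finally show ?case
    using insert by simp
qed simp

text \<open>
  There are at most \<open>n - 2\<close> possibilities for a pair of consecutive elements, and
  \<open>(n - 2) * (n - 2)! \<le> n!/n\<close>.
\<close>

lemma sum_weight_not_separated_le:
  assumes "1 \<le> n"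
  shows "(\<Sum>V | V \<subseteq> {1..<n} \<and> (\<exists>v\<in>V. Suc v \<in> V). real m ^ card V * fact (n - card V))
    \<le> real m ^ 2 * exp (real m) * fact n / real n"
proof -
  let ?b = "\<lambda>V. real m ^ card V * fact (n - card V)"
  let ?S = "\<lambda>v. {V. V \<subseteq> {1..<n} \<and> v \<in> V \<and> Suc v \<in> V}"
  have fin: "finite (?S v)" for v
    by (rule finite_subset[of _ "Pow {1..<n}"]) auto
  have "{V. V \<subseteq> {1..<n} \<and> (\<exists>v\<in>V. Suc v \<in> V)} = (\<Union>v\<in>{1..<n - 1}. ?S v)"
    by fastforce
  then have "(\<Sum>V | V \<subseteq> {1..<n} \<and> (\<exists>v\<in>V. Suc v \<in> V). ?b V) = sum ?b (\<Union>v\<in>{1..<n - 1}. ?S v)"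
    by simp
  also have "\<dots> \<le> (\<Sum>v\<in>{1..<n - 1}. sum ?b (?S v))"
    using sum_UN_le[of "{1..<n - 1}" ?S ?b] fin by simp
  also have "\<dots> \<le> (\<Sum>v\<in>{1..<n - 1}. real m ^ 2 * exp (real m) * fact (n - 2))"
    by (intro sum_mono sum_weight_consecutive_le) auto
  also have "\<dots> = real m ^ 2 * exp (real m) * (real (n - 2) * fact (n - 2))"
    by (simp add: numeral_2_eq_2 One_nat_def)
  also have "\<dots> \<le> real m ^ 2 * exp (real m) * (fact n / real n)"
  proof (intro mult_left_mono)
    show "real (n - 2) * fact (n - 2) \<le> fact n / real n"
    proof (cases "2 \<le> n")
      case True
      then obtain N where "n = Suc (Suc N)"
        by (metis add_2_eq_Suc le_Suc_ex)
      then show ?thesis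
        by (simp add: field_simps)
    qed auto
  qed auto
  finally show ?thesis
    by simp
qed

text \<open>
  The sets of size \<open>k < n\<close> contribute \<open>(-m)^k/k! * (1 - k/n)\<close> after division by \<open>n!\<close>. So the
  coefficients of the series for \<open>exp (- m)\<close> are perturbed by a relative error of at most \<open>k/n\<close>,
  which also bounds the missing terms with \<open>k \<ge> n\<close>; then \<open>k \<le> 2 ^ k\<close> makes the total error an
  exponential series with argument \<open>2 m\<close>.
\<close>

lemma sum_weight_approx_exp:
  assumes "1 \<le> n"
  shows "\<bar>(\<Sum>V\<in>Pow {1..<n}. (-1) ^ card V * (real m ^ card V * fact (n - card V))) / fact n
      - exp (- real m)\<bar> \<le> exp (2 * real m) / real n"
proof -
  \<comment> \<open>\<open>c k\<close> is the relative error of the \<open>k\<close>-th term; beyond the range of summation the whole term is missing.\<close>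
  define c where "c k = (if k < n then real k / real n else 1)" for k
  define e where "e k = (- real m) ^ k / fact k" for k
  obtain N where N: "n = Suc N"
    using assms by (cases n) (auto simp: One_nat_def)
  have "(\<Sum>V\<in>Pow {1..<n}. (-1) ^ card V * (real m ^ card V * fact (n - card V)))
      = (\<Sum>k\<le>N. real (N choose k) * ((-1) ^ k * (real m ^ k * fact (n - k))))"
    using sum_Pow_card[of "{1..<n}" "\<lambda>k. (-1) ^ k * (real m ^ k * fact (n - k))"] by (simp add: N)
  also have "\<dots> = (\<Sum>k\<le>N. fact n * (e k - e k * c k))"
  proof (rule sum.cong[OF refl])
    fix k assume "k \<in> {..N}"
    then have k: "k \<le> N" "k < n"
      by (auto simp: N)
    have "real (N choose k) * ((-1) ^ k * (real m ^ k * fact (n - k)))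
        = (- real m) ^ k * (real (N choose k) * fact (Suc N - k))"
      by (simp add: N power_minus[of "real m"])
    also have "\<dots> = (- real m) ^ k * (fact N * real (n - k) / fact k)"
      by (simp only: choose_fact_eq[OF k(1)] N)
    also have "real (n - k) = real n * (1 - c k)"
      using k by (simp add: c_def of_nat_diff field_simps)
    also have "fact N * (real n * (1 - c k)) = fact n * (1 - c k)"
      by (simp add: N)
    finally show "real (N choose k) * ((-1) ^ k * (real m ^ k * fact (n - k)))
        = fact n * (e k - e k * c k)"
      by (simp add: e_def field_simps)
  qed
  also have "\<dots> = fact n * (\<Sum>k\<le>N. e k - e k * c k)"
    by (simp only: sum_distrib_left)
  finally have main: "(\<Sum>V\<in>Pow {1..<n}. (-1) ^ card V * (real m ^ card V * fact (n - card V))) / fact n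
      = (\<Sum>k\<le>N. e k - e k * c k)"
    by simp
  have e: "e sums exp (- real m)"
    using exp_converges[of "- real m"] by (simp add: e_def[abs_def] scaleR_conv_of_real field_simps)
  moreover have "(\<lambda>k. e k - e k * c k) sums (\<Sum>k\<le>N. e k - e k * c k)"
    by (rule sums_finite) (auto simp: c_def N)
  ultimately have "(\<lambda>k. e k - (e k - e k * c k)) sums (exp (- real m) - (\<Sum>k\<le>N. e k - e k * c k))"
    by (rule sums_diff)
  then have diff: "(\<lambda>k. e k * c k) sums (exp (- real m) - (\<Sum>k\<le>N. e k - e k * c k))"
    by simp
  have bound: "norm (e k * c k) \<le> (2 * real m) ^ k / fact k / real n" for k
  proof -
    have "0 \<le> c k"
      by (simp add: c_def)
    have "c k \<le> real k / real n"
      using assms by (auto simp: c_def)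
    also have "\<dots> \<le> 2 ^ k / real n"
      using of_nat_less_two_power[of k, where ?'a = real] by (intro divide_right_mono) auto
    finally have "\<bar>e k\<bar> * c k \<le> \<bar>e k\<bar> * (2 ^ k / real n)"
      by (intro mult_left_mono) auto
    moreover have "\<bar>e k\<bar> = real m ^ k / fact k"
      by (simp add: e_def power_abs)
    ultimately show ?thesis
      using \<open>0 \<le> c k\<close> by (simp add: abs_mult power_mult_distrib mult_ac)
  qed
  have "(\<lambda>k. (2 * real m) ^ k / fact k) sums exp (2 * real m)"
    using exp_converges[of "2 * real m"] by (simp add: scaleR_conv_of_real field_simps)
  then have "(\<lambda>k. (2 * real m) ^ k / fact k / real n) sums (exp (2 * real m) / real n)"
    by (rule sums_divide)
  with diff bound have "norm (exp (- real m) - (\<Sum>k\<le>N. e k - e k * c k)) \<le> exp (2 * real m) / real n"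
    using norm_suminf_le[of "\<lambda>k. e k * c k" "\<lambda>k. (2 * real m) ^ k / fact k / real n"]
    by (simp add: sums_iff)
  then show ?thesis
    by (simp add: main abs_minus_commute)
qed

definition free_of :: "bool set \<Rightarrow> nat \<Rightarrow> nat list set" where
  "free_of T n = {xs \<in> permutations_of_set {1..n}. \<forall>v\<in>{1..<n}. \<not> beside T xs v}"

text \<open>
  In the inclusion-exclusion formula the number of permutations aligned along \<open>V\<close> is replaced by its
  upper bound from \<open>card_aligned\<close>. The replacement changes only the terms of sets with two consecutive
  elements, and there by no more than the bound itself.
\<close>

lemma card_free_of_approx:
  fixes T :: "bool set"
  assumes "1 \<le> n"
  defines "m \<equiv> real (card T)"
  shows "\<bar>card (free_of T n) / fact n - exp (- m)\<bar> \<le> (m ^ 2 * exp m + exp (2 * m)) / real n"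
proof -
  let ?a = "\<lambda>V. real (card (aligned T {1..n} V))"
  let ?b = "\<lambda>V. m ^ card V * fact (n - card V)"
  let ?bad = "{V. V \<subseteq> {1..<n} \<and> (\<exists>v\<in>V. Suc v \<in> V)}"
  have "real (card (free_of T n)) = (\<Sum>V\<in>Pow {1..<n}. (-1) ^ card V * ?a V)"
    unfolding free_of_def aligned_def by (rule card_avoid_all) auto
  then have "\<bar>card (free_of T n) - (\<Sum>V\<in>Pow {1..<n}. (-1) ^ card V * ?b V)\<bar>
      = \<bar>\<Sum>V\<in>Pow {1..<n}. (-1) ^ card V * (?a V - ?b V)\<bar>"
    by (simp add: right_diff_distrib sum_subtractf)
  also have "\<dots> \<le> (\<Sum>V\<in>Pow {1..<n}. \<bar>?a V - ?b V\<bar>)"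
    by (rule order_trans[OF sum_abs]) (simp add: abs_mult)
  also have "\<dots> = (\<Sum>V\<in>?bad. \<bar>?a V - ?b V\<bar>)"
  proof (rule sum.mono_neutral_right)
    show "\<forall>V\<in>Pow {1..<n} - ?bad. \<bar>?a V - ?b V\<bar> = 0"
    proof
      fix V assume V: "V \<in> Pow {1..<n} - ?bad"
      then have "finite V" "V \<union> Suc ` V \<subseteq> {1..n}" "\<forall>v\<in>V. Suc v \<notin> V"
        by (auto intro: finite_subset)
      then show "\<bar>?a V - ?b V\<bar> = 0"
        by (simp add: card_aligned m_def)
    qed
  qed auto
  also have "\<dots> \<le> (\<Sum>V\<in>?bad. ?b V)"
  proof (rule sum_mono)
    fix V assume V: "V \<in> ?bad"
    then have "finite V" "V \<union> Suc ` V \<subseteq> {1..n}"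
      by (auto intro: finite_subset)
    then have "card (aligned T {1..n} V) \<le> card T ^ card V * fact (n - card V)"
      using card_aligned(1)[of V "{1..n}" T] by simp
    then have "?a V \<le> ?b V"
      unfolding m_def by (metis of_nat_fact of_nat_le_iff of_nat_mult of_nat_power)
    then show "\<bar>?a V - ?b V\<bar> \<le> ?b V"
      by simp
  qed
  also have "\<dots> \<le> m ^ 2 * exp m * fact n / real n"
    using sum_weight_not_separated_le[OF assms(1)] by (simp add: m_def)
  finally have "\<bar>card (free_of T n) - (\<Sum>V\<in>Pow {1..<n}. (-1) ^ card V * ?b V)\<bar> / fact n
      \<le> m ^ 2 * exp m / real n"
    by (simp add: divide_le_eq)
  then have "\<bar>card (free_of T n) / fact n - (\<Sum>V\<in>Pow {1..<n}. (-1) ^ card V * ?b V) / fact n\<bar>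
      \<le> m ^ 2 * exp m / real n"
    by (simp flip: diff_divide_distrib)
  moreover have "\<bar>(\<Sum>V\<in>Pow {1..<n}. (-1) ^ card V * ?b V) / fact n - exp (- m)\<bar> \<le> exp (2 * m) / real n"
    using sum_weight_approx_exp[OF assms(1)] by (simp add: m_def)
  ultimately show ?thesis
    by (simp add: add_divide_distrib)
qed

lemma opposing_if_not_free:
  assumes "xs \<in> permutations_of_set {1..n}" "xs \<notin> free_of {True} n" "xs \<notin> free_of {False} n"
  shows "opposing xs"
proof -
  obtain u where "follows xs u (Suc u)"
    using assms(1,2) by (auto simp: free_of_def beside_def next_to_def)
  moreover obtain v where "follows xs (Suc v) v"
    using assms(1,3) by (auto simp: free_of_def beside_def next_to_def)
  ultimately have "adjacency xs u (Suc u)" "adjacency xs (Suc v) v"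
    by (auto simp: adjacency_def)
  then show ?thesis
    unfolding opposing_def by blast
qed

section \<open>Vanishing of the principal Moebius function\<close>

theorem corollary36:
  shows "\<exists>C::real. \<forall>n::nat. n \<ge> 1 \<longrightarrow>
    measure_pmf.prob (pmf_of_set (permutations_of_set {1..n})) {\<pi>. perm_mobius [1] \<pi> = 0}
      \<ge> (1 - 1 / exp 1)\<^sup>2 - C / real n"
proof -
  \<comment> \<open>The error constants of \<open>card_free_of_approx\<close> for one and for two directions.\<close>
  define C1 :: real where "C1 = exp 1 + exp 2"
  define C2 :: real where "C2 = 4 * exp 2 + exp 4"
  show ?thesis
  proof (intro exI[of _ "2 * C1 + C2"] allI impI)
    fix n :: nat assume n: "n \<ge> 1"
    let ?\<Omega> = "permutations_of_set {1..n}" and ?Z = "{\<pi>. perm_mobius [1] \<pi> = 0}"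
    let ?A = "free_of {True} n" and ?B = "free_of {False} n"
    have \<Omega>: "finite ?\<Omega>" "?\<Omega> \<noteq> {}" "card ?\<Omega> = fact n"
      by auto
    have "?A \<inter> ?B = free_of {True, False} n"
      by (auto simp: free_of_def beside_def)
    then have inter: "\<bar>card (?A \<inter> ?B) / fact n - exp (- 2)\<bar> \<le> C2 / real n"
      using card_free_of_approx[OF n, of "{True, False}"] by (simp add: C2_def)
    have single: "\<bar>card (free_of {d} n) / fact n - exp (- 1)\<bar> \<le> C1 / real n" for d
      using card_free_of_approx[OF n, of "{d}"] by (simp add: C1_def)
    have fin: "finite ?A" "finite ?B"
      by (auto simp: free_of_def)
    have "?\<Omega> - (?A \<union> ?B) \<subseteq> ?\<Omega> \<inter> ?Z"
    proof
      fix \<pi> assume \<pi>: "\<pi> \<in> ?\<Omega> - (?A \<union> ?B)"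
      then have "is_perm \<pi>"
        using length_finite_permutations_of_set[of \<pi> "{1..n}"] by (simp add: is_perm_def)
      then show "\<pi> \<in> ?\<Omega> \<inter> ?Z"
        using \<pi> opposing_if_not_free[of \<pi> n] perm_mobius_opposing by auto
    qed
    then have "card (?\<Omega> - (?A \<union> ?B)) \<le> card (?\<Omega> \<inter> ?Z)"
      using \<Omega>(1) by (intro card_mono) auto
    moreover have "card (?\<Omega> - (?A \<union> ?B)) + card (?A \<union> ?B) = fact n"
    proof -
      have "?\<Omega> \<inter> (?A \<union> ?B) = ?A \<union> ?B"
        by (auto simp: free_of_def)
      then show ?thesis
        using card_Int_Diff[OF \<Omega>(1), of "?A \<union> ?B"] \<Omega>(3) by simp
    qed
    moreover have "card (?A \<union> ?B) + card (?A \<inter> ?B) = card ?A + card ?B"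
      using card_Un_Int[OF fin] by simp
    ultimately have "fact n + card (?A \<inter> ?B) \<le> card (?\<Omega> \<inter> ?Z) + (card ?A + card ?B)"
      by linarith
    then have "real (fact n + card (?A \<inter> ?B)) \<le> real (card (?\<Omega> \<inter> ?Z) + (card ?A + card ?B))"
      by (simp only: of_nat_le_iff)
    then have "fact n - (real (card ?A) + real (card ?B)) + real (card (?A \<inter> ?B)) \<le> real (card (?\<Omega> \<inter> ?Z))"
      by simp
    then have "(fact n - (real (card ?A) + real (card ?B)) + real (card (?A \<inter> ?B))) / fact n
        \<le> real (card (?\<Omega> \<inter> ?Z)) / fact n"
      by (rule divide_right_mono) simp
    also have "\<dots> = measure_pmf.prob (pmf_of_set ?\<Omega>) ?Z"
      using \<Omega> by (simp add: measure_pmf_of_set)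
    finally have "1 - card ?A / fact n - card ?B / fact n + card (?A \<inter> ?B) / fact n
        \<le> measure_pmf.prob (pmf_of_set ?\<Omega>) ?Z"
      by (simp add: add_divide_distrib diff_divide_distrib)
    moreover have "(1 - 1 / exp 1)\<^sup>2 = 1 - 2 * exp (- 1) + exp (- 2 :: real)"
    proof -
      have "exp (- 2 :: real) = exp (- 1) * exp (- 1)"
        by (simp flip: exp_add)
      then show ?thesis
        by (simp add: power2_eq_square exp_minus field_simps)
    qed
    moreover have "(2 * C1 + C2) / real n = C1 / real n + C1 / real n + C2 / real n"
      by (simp add: add_divide_distrib)
    ultimately show "measure_pmf.prob (pmf_of_set ?\<Omega>) ?Z \<ge> (1 - 1 / exp 1)\<^sup>2 - (2 * C1 + C2) / real n"
      using inter single[of True] single[of False] by (simp only: abs_le_iff) linarith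
  qed
qed

end
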